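(* Let $p$ and $n$ be positive integers and $q\in(0,1)$. Let $a_1,\ldots,a_n,b_1,\ldots,b_n$ be real numbers such that $0<a_1\le a_2\le\cdots\le a_n$, $0<b_1\le b_2\le\cdots\le b_n$ and $\sum_{i=1}^{k}a_i\le\sum_{i=1}^{k}b_i$ for $k=1,2,\ldots,n$. Then the function $$G_{p,q}(x)=\prod_{i=1}^{n}\frac{\Gamma_{p,q}(x+a_i)}{\Gamma_{p,q}(x+b_i)}$$ is completely monotonic on $(0,\infty)$.
   Context: For $q\in(0,1)$ and real $x$, $[x]_q=\frac{1-q^x}{1-q}$, and for a positive integer $p$, $[p]_q!=[1]_q[2]_q\cdots[p]_q$. For $x>0$, $\Gamma_{p,q}(x)=\frac{[p]_q^{x}\,[p]_q!}{[x]_q[x+1]_q\cdots[x+p]_q}$. A function $f$ is completely monotonic on an open interval $I$ if it has derivatives of all orders on $I$ and $(-1)^n f^{(n)}(x)\ge0$ for all $x\in I$ and all $n=0,1,2,\ldots$. *)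

theory Defs
  imports "HOL-Analysis.Analysis"
begin

definition q_bracket :: "real \<Rightarrow> real \<Rightarrow> real" where
  "q_bracket q x = (1 - q powr x) / (1 - q)"

definition q_fact :: "real \<Rightarrow> nat \<Rightarrow> real" where
  "q_fact q p = (\<Prod>k=1..p. q_bracket q (real k))"

(* The (p,q)-Gamma function; only its values at x > 0 are meaningful. *)
definition Gamma_pq :: "nat \<Rightarrow> real \<Rightarrow> real \<Rightarrow> real" where
  "Gamma_pq p q x =
     q_bracket q (real p) powr x * q_fact q p / (\<Prod>k=0..p. q_bracket q (x + real k))"

(* Meant for an open interval I. Then deriv at a point of I only depends on the values on I,
   so (deriv ^^ n) f is the n-th derivative on I as soon as the first conjunct holds; that conjunct
   is needed because deriv is an arbitrary value where no derivative exists. *)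
definition completely_monotonic_on :: "real set \<Rightarrow> (real \<Rightarrow> real) \<Rightarrow> bool" where
  "completely_monotonic_on I f \<longleftrightarrow>
     (\<forall>n. \<forall>x\<in>I. (deriv ^^ n) f differentiable (at x)) \<and>
     (\<forall>n. \<forall>x\<in>I. (-1) ^ n * (deriv ^^ n) f x \<ge> 0)"

end

theory Submission
  imports Defs
begin

text \<open>
  Put \<open>t = q powr x\<close>. In the quotient of two \<open>(p,q)\<close>-Gamma functions the factorials cancel, and
  the whole product becomes a positive constant times
  \<open>\<Prod>\<^sub>i \<Prod>\<^sub>k (1 - \<beta>\<^sub>i\<^sub>k t) / (1 - \<alpha>\<^sub>i\<^sub>k t)\<close> with \<open>\<alpha>\<^sub>i\<^sub>k = q powr (a i + k)\<close> and
  \<open>\<beta>\<^sub>i\<^sub>k = q powr (b i + k)\<close>. All \<open>\<alpha>\<^sub>i\<^sub>k\<close> are below 1, so the product is a power series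
  in \<open>t\<close> that converges for \<open>\<bar>t\<bar> < 1\<close>. A power series in \<open>q powr x\<close> with nonnegative coefficients is
  completely monotonic, because each differentiation in \<open>x\<close> multiplies the \<open>m\<close>-th coefficient by
  \<open>m * ln q \<le> 0\<close> (\<open>completely_monotonic_on_power_series\<close>). It remains to see that the coefficients
  are nonnegative.

  The formal logarithmic derivative of the product has the coefficients
  \<open>\<Sum>\<^sub>i \<Sum>\<^sub>k (\<alpha>\<^sub>i\<^sub>k ^ (m + 1) - \<beta>\<^sub>i\<^sub>k ^ (m + 1))\<close>. With \<open>s = q ^ (m + 1)\<close> the summand
  is \<open>s ^ k * (s powr a i - s powr b i)\<close>, so these are nonnegative as soon as
  \<open>\<Sum>\<^sub>i s powr b i \<le> \<Sum>\<^sub>i s powr a i\<close>. This is the weak majorization inequality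
  for the decreasing convex function \<open>u \<mapsto> s powr u\<close> (\<open>sum_powr_le_of_partial_sums_le\<close>). Finally, a
  series with nonnegative constant term and a logarithmic derivative with nonnegative coefficients
  has nonnegative coefficients itself, by the recursion that \<open>F' = D F\<close> gives for them
  (\<open>fps_nonneg_of_log_deriv_nonneg\<close>).
\<close>

section \<open>Weak majorization for exponentials\<close>

text \<open>
  Abel summation in inductive form. The lower bound \<open>w n * (\<Sum>i=1..n. d i)\<close> is what survives the
  passage from \<open>n\<close> to \<open>n + 1\<close>: the total so far is nonnegative, so replacing its weight \<open>w n\<close> by
  the smaller \<open>w (n + 1)\<close> only decreases it.
\<close>

lemma weighted_sum_ge_last_weight:
  fixes w d :: "nat \<Rightarrow> real"
  assumes "n \<ge> 1"
    and decr: "\<And>i. 1 \<le> i \<Longrightarrow> i < n \<Longrightarrow> w (i + 1) \<le> w i"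
    and partial: "\<And>k. 1 \<le> k \<Longrightarrow> k \<le> n \<Longrightarrow> 0 \<le> (\<Sum>i=1..k. d i)"
  shows "w n * (\<Sum>i=1..n. d i) \<le> (\<Sum>i=1..n. w i * d i)"
  using assms
proof (induction n rule: dec_induct)
  case base
  then show ?case by simp
next
  case (step n)
  have "w (Suc n) * (\<Sum>i=1..Suc n. d i) = w (Suc n) * (\<Sum>i=1..n. d i) + w (Suc n) * d (Suc n)"
    using step.hyps by (simp add: algebra_simps)
  also have "w (Suc n) * (\<Sum>i=1..n. d i) \<le> w n * (\<Sum>i=1..n. d i)"
    using step.prems(1)[of n] step.prems(2)[of n] step.hyps by (intro mult_right_mono) auto
  also have "w n * (\<Sum>i=1..n. d i) \<le> (\<Sum>i=1..n. w i * d i)"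
    using step.prems by (intro step.IH) auto
  also have "(\<Sum>i=1..n. w i * d i) + w (Suc n) * d (Suc n) = (\<Sum>i=1..Suc n. w i * d i)"
    using step.hyps by simp
  finally show ?case by simp
qed

text \<open>
  The graph of the convex function \<open>u \<mapsto> s powr u\<close> lies above its tangent at \<open>b i\<close>, which reduces
  the claim to \<open>\<Sum>i. w i * (b i - a i) \<ge> 0\<close> for the weights \<open>w i = - ln s * s powr b i\<close>. They are
  nonnegative and decrease because \<open>b\<close> increases.
\<close>

lemma sum_powr_le_of_partial_sums_le:
  fixes a b :: "nat \<Rightarrow> real" and s :: real
  assumes n: "n \<ge> 1" and s: "0 < s" "s \<le> 1"
    and b: "\<And>i. 1 \<le> i \<Longrightarrow> i < n \<Longrightarrow> b i \<le> b (i + 1)"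
    and partial: "\<And>k. 1 \<le> k \<Longrightarrow> k \<le> n \<Longrightarrow> (\<Sum>i=1..k. a i) \<le> (\<Sum>i=1..k. b i)"
  shows "(\<Sum>i=1..n. s powr b i) \<le> (\<Sum>i=1..n. s powr a i)"
proof -
  define w where "w i = - ln s * s powr b i" for i
  have ln: "- ln s \<ge> 0" using s by simp
  have "0 \<le> w n * (\<Sum>i=1..n. b i - a i)"
    unfolding w_def using partial[of n] n
    by (intro mult_nonneg_nonneg ln) (auto simp: sum_subtractf)
  also have "\<dots> \<le> (\<Sum>i=1..n. w i * (b i - a i))"
  proof (rule weighted_sum_ge_last_weight[OF n])
    fix i assume "1 \<le> i" "i < n"
    then show "w (i + 1) \<le> w i"
      unfolding w_def using ln s b by (intro mult_left_mono powr_mono') auto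
  qed (use partial in \<open>auto simp: sum_subtractf\<close>)
  also have "\<dots> \<le> (\<Sum>i=1..n. s powr a i - s powr b i)"
  proof (rule sum_mono)
    fix i
    have "s powr b i * (1 + (a i - b i) * ln s) \<le> s powr b i * exp ((a i - b i) * ln s)"
      by (intro mult_left_mono exp_ge_add_one_self) auto
    also have "\<dots> = s powr a i"
      using s by (simp add: powr_def flip: exp_add) (simp add: algebra_simps)
    finally show "w i * (b i - a i) \<le> s powr a i - s powr b i"
      by (simp add: w_def algebra_simps)
  qed
  finally show ?thesis by (simp add: sum_subtractf)
qed

section \<open>Formal logarithmic derivatives\<close>

text \<open>
  Comparing coefficients in \<open>F' = D F\<close> gives \<open>(m + 1) F\<^sub>m\<^sub>+\<^sub>1 = \<Sum>\<^sub>i D\<^sub>i F\<^sub>m\<^sub>-\<^sub>i\<close>, which expresses each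
  coefficient of \<open>F\<close> through earlier ones with nonnegative weights.
\<close>

lemma fps_nonneg_of_log_deriv_nonneg:
  fixes F D :: "real fps"
  assumes FD: "fps_deriv F = D * F"
    and D: "\<And>m. 0 \<le> fps_nth D m" and F0: "0 \<le> fps_nth F 0"
  shows "0 \<le> fps_nth F m"
proof (induction m rule: less_induct)
  case (less m)
  show ?case
  proof (cases m)
    case 0
    then show ?thesis using F0 by simp
  next
    case (Suc k)
    have "real (k + 1) * fps_nth F (k + 1) = fps_nth (D * F) k"
      by (simp flip: FD)
    also have "\<dots> = (\<Sum>i=0..k. fps_nth D i * fps_nth F (k - i))"
      by (simp add: fps_mult_nth)
    also have "\<dots> \<ge> 0"
      using Suc by (intro sum_nonneg mult_nonneg_nonneg D less) auto
    finally show ?thesis using Suc by (simp add: zero_le_mult_iff)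
  qed
qed

lemma fps_log_deriv_prod:
  fixes F D :: "'i \<Rightarrow> 'a :: comm_ring_1 fps"
  assumes "finite A" and "\<And>j. j \<in> A \<Longrightarrow> fps_deriv (F j) = D j * F j"
  shows "fps_deriv (\<Prod>j\<in>A. F j) = (\<Sum>j\<in>A. D j) * (\<Prod>j\<in>A. F j)"
  using assms by (induction A rule: finite_induct) (simp_all add: algebra_simps)

lemma fps_nth_0_prod:
  fixes F :: "'i \<Rightarrow> 'a :: comm_ring_1 fps"
  shows "fps_nth (\<Prod>j\<in>A. F j) 0 = (\<Prod>j\<in>A. fps_nth (F j) 0)"
  by (induction A rule: infinite_finite_induct) simp_all

definition geometric_fps :: "'a :: comm_ring_1 \<Rightarrow> 'a fps" where
  "geometric_fps c = Abs_fps (\<lambda>m. c ^ m)"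

text \<open>The expansion of \<open>(1 - \<beta> t) / (1 - \<alpha> t)\<close> in powers of \<open>t\<close>.\<close>

definition linear_quotient_fps :: "'a :: comm_ring_1 \<Rightarrow> 'a \<Rightarrow> 'a fps" where
  "linear_quotient_fps \<alpha> \<beta> = (1 - fps_const \<beta> * fps_X) * geometric_fps \<alpha>"

lemma geometric_fps_inverse: "(1 - fps_const c * fps_X) * geometric_fps c = 1"
proof (rule fps_ext)
  fix m
  show "fps_nth ((1 - fps_const c * fps_X) * geometric_fps c) m = fps_nth 1 m"
    by (cases m) (simp_all add: geometric_fps_def left_diff_distrib mult.assoc)
qed

text \<open>Differentiate \<open>(1 - c t) g = 1\<close> and multiply the result by \<open>g\<close>.\<close>

lemma fps_deriv_geometric_fps:
  "fps_deriv (geometric_fps c) = fps_const c * geometric_fps c * geometric_fps c"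
proof -
  let ?g = "geometric_fps c" and ?l = "1 - fps_const c * fps_X"
  have "?l * fps_deriv ?g = fps_const c * ?g"
    using arg_cong[OF geometric_fps_inverse[of c], of fps_deriv] by (simp add: algebra_simps)
  then have "(?l * ?g) * fps_deriv ?g = fps_const c * ?g * ?g" by (simp only: mult_ac)
  then show ?thesis by (simp only: geometric_fps_inverse mult_1_left)
qed

text \<open>
  The logarithmic derivative of \<open>(1 - \<beta> t) / (1 - \<alpha> t)\<close> is
  \<open>\<alpha> / (1 - \<alpha> t) - \<beta> / (1 - \<beta> t)\<close>, a difference of two geometric series.
\<close>

lemma fps_deriv_linear_quotient_fps:
  "fps_deriv (linear_quotient_fps \<alpha> \<beta>) =
     Abs_fps (\<lambda>m. \<alpha> ^ (m + 1) - \<beta> ^ (m + 1)) * linear_quotient_fps \<alpha> \<beta>"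
proof -
  let ?l = "1 - fps_const \<beta> * fps_X"
  let ?g = "geometric_fps \<alpha>" and ?h = "geometric_fps \<beta>"
  have D: "Abs_fps (\<lambda>m. \<alpha> ^ (m + 1) - \<beta> ^ (m + 1)) = fps_const \<alpha> * ?g - fps_const \<beta> * ?h"
    by (rule fps_ext) (simp add: geometric_fps_def)
  have "fps_deriv (?l * ?g) = fps_const \<alpha> * ?g * (?l * ?g) - fps_const \<beta> * ?g"
    by (simp add: fps_deriv_geometric_fps algebra_simps)
  also have "fps_const \<beta> * ?g = fps_const \<beta> * ((?l * ?h) * ?g)"
    by (simp add: geometric_fps_inverse)
  also have "\<dots> = fps_const \<beta> * ?h * (?l * ?g)"
    by (simp only: mult_ac)
  also have "fps_const \<alpha> * ?g * (?l * ?g) - \<dots> = (fps_const \<alpha> * ?g - fps_const \<beta> * ?h) * (?l * ?g)"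
    by (rule left_diff_distrib[symmetric])
  finally show ?thesis by (simp only: D linear_quotient_fps_def)
qed

section \<open>Evaluation in the unit disc\<close>

lemma less_conv_radius:
  "norm z < 1 \<Longrightarrow> 1 \<le> fps_conv_radius F \<Longrightarrow> ereal (norm z) < fps_conv_radius F"
  by (rule order_less_le_trans[of _ 1]) simp_all

lemma fps_conv_radius_prod_ge:
  fixes F :: "'i \<Rightarrow> 'a :: {banach, real_normed_field} fps"
  assumes "finite A" and "\<And>j. j \<in> A \<Longrightarrow> r \<le> fps_conv_radius (F j)"
  shows "r \<le> fps_conv_radius (\<Prod>j\<in>A. F j)"
  using assms
proof (induction A rule: finite_induct)
  case (insert j A)
  then have "r \<le> min (fps_conv_radius (F j)) (fps_conv_radius (\<Prod>j\<in>A. F j))" by simp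
  also have "\<dots> \<le> fps_conv_radius (F j * (\<Prod>j\<in>A. F j))" by (rule fps_conv_radius_mult)
  finally show ?case using insert.hyps by simp
qed simp

lemma eval_fps_prod:
  fixes F :: "'i \<Rightarrow> 'a :: {banach, real_normed_field} fps"
  assumes "finite A" and "\<And>j. j \<in> A \<Longrightarrow> r \<le> fps_conv_radius (F j)" and "norm z < r"
  shows "eval_fps (\<Prod>j\<in>A. F j) z = (\<Prod>j\<in>A. eval_fps (F j) z)"
  using assms
proof (induction A rule: finite_induct)
  case (insert j A)
  then have "r \<le> fps_conv_radius (F j)" "r \<le> fps_conv_radius (\<Prod>j\<in>A. F j)"
    by (auto intro: fps_conv_radius_prod_ge)
  moreover have "ereal (norm z) < ereal r" using insert.prems by simp
  ultimately have "eval_fps (F j * (\<Prod>j\<in>A. F j)) z = eval_fps (F j) z * eval_fps (\<Prod>j\<in>A. F j) z"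
    by (intro eval_fps_mult) (rule order_less_le_trans, assumption+)+
  then show ?case using insert by simp
qed simp

lemma fps_conv_radius_geometric_fps:
  fixes c :: "'a :: {banach, real_normed_field}"
  assumes "norm c \<le> 1"
  shows "1 \<le> fps_conv_radius (geometric_fps c)"
  unfolding fps_conv_radius_def
proof (rule conv_radius_geI_ex)
  fix r :: real assume r: "0 < r" "ereal r < 1"
  have "norm c * r \<le> 1 * r"
    using assms r by (intro mult_right_mono) auto
  also have "\<dots> < 1" using r by simp
  finally have "norm (c * of_real r) < 1" using r by (simp add: norm_mult)
  then have "summable (\<lambda>m. fps_nth (geometric_fps c) m * of_real r ^ m)"
    using summable_geometric[of "c * of_real r"]
    by (simp only: geometric_fps_def fps_nth_Abs_fps power_mult_distrib)
  moreover have "norm (of_real r :: 'a) = r" using r by simp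
  ultimately show "\<exists>z. norm z = r \<and> summable (\<lambda>m. fps_nth (geometric_fps c) m * z ^ m)"
    by blast
qed

lemma fps_conv_radius_linear_quotient_fps:
  fixes \<alpha> \<beta> :: "'a :: {banach, real_normed_field}"
  assumes "norm \<alpha> \<le> 1"
  shows "1 \<le> fps_conv_radius (linear_quotient_fps \<alpha> \<beta>)"
proof -
  have "\<infinity> \<le> fps_conv_radius (1 - fps_const \<beta> * fps_X :: 'a fps)"
    using fps_conv_radius_diff[of 1 "fps_const \<beta> * fps_X"]
      fps_conv_radius_mult[of "fps_const \<beta>" fps_X] by simp
  then show ?thesis
    using fps_conv_radius_mult[of "1 - fps_const \<beta> * fps_X" "geometric_fps \<alpha>"]
      fps_conv_radius_geometric_fps[OF assms]
    by (simp add: linear_quotient_fps_def)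
qed

lemma eval_linear_quotient_fps:
  fixes \<alpha> \<beta> z :: "'a :: {banach, real_normed_field}"
  assumes "norm \<alpha> \<le> 1" and "norm z < 1"
  shows "eval_fps (linear_quotient_fps \<alpha> \<beta>) z = (1 - \<beta> * z) / (1 - \<alpha> * z)"
proof -
  have rad: "fps_conv_radius (fps_const \<beta> * fps_X :: 'a fps) = \<infinity>"
    "fps_conv_radius (1 - fps_const \<beta> * fps_X :: 'a fps) = \<infinity>"
    using fps_conv_radius_diff[of 1 "fps_const \<beta> * fps_X"]
      fps_conv_radius_mult[of "fps_const \<beta>" fps_X] by simp_all
  have "norm (\<alpha> * z) < 1"
    using mult_right_mono[OF assms(1), of "norm z"] assms(2) by (simp add: norm_mult)
  then have "eval_fps (geometric_fps \<alpha>) z = 1 / (1 - \<alpha> * z)"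
    by (simp add: eval_fps_def geometric_fps_def suminf_geometric flip: power_mult_distrib)
  moreover have "ereal (norm z) < fps_conv_radius (geometric_fps \<alpha>)"
    using assms by (intro less_conv_radius fps_conv_radius_geometric_fps)
  ultimately show ?thesis
    by (simp add: linear_quotient_fps_def eval_fps_mult eval_fps_diff rad)
qed

section \<open>Power series in an exponential\<close>

lemma fps_conv_radius_XD:
  fixes F :: "'a :: {banach, real_normed_field} fps"
  shows "fps_conv_radius F \<le> fps_conv_radius (fps_XD F)"
  using fps_conv_radius_mult[of fps_X "fps_deriv F"] fps_conv_radius_deriv[of F]
  by (simp add: fps_XD_def)

text \<open>By the chain rule, \<open>d/dx = ln q * (t d/dt)\<close> for \<open>t = q powr x\<close>.\<close>

lemma has_field_derivative_eval_fps_powr: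
  fixes F :: "real fps"
  assumes "0 < q" and "ereal (q powr x) < fps_conv_radius F"
  shows "((\<lambda>x. eval_fps F (q powr x)) has_field_derivative
           ln q * eval_fps (fps_XD F) (q powr x)) (at x)"
proof -
  have "ereal (q powr x) < fps_conv_radius (fps_deriv F)"
    using assms(2) fps_conv_radius_deriv[of F] by (rule order_less_le_trans)
  then have "eval_fps (fps_XD F) (q powr x) = q powr x * eval_fps (fps_deriv F) (q powr x)"
    by (simp add: fps_XD_def eval_fps_mult)
  moreover have "((\<lambda>x. q powr x) has_field_derivative ln q * q powr x) (at x)"
    using assms(1) by (auto intro!: derivative_eq_intros)
  moreover have "(eval_fps F has_field_derivative eval_fps (fps_deriv F) (q powr x)) (at (q powr x))"
    using assms by (intro has_field_derivative_eval_fps) simp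
  ultimately show ?thesis
    using DERIV_chain2[of "eval_fps F" _ "\<lambda>x. q powr x" x] by (fastforce simp: mult_ac)
qed

text \<open>
  The \<open>n\<close>-th derivative is \<open>(ln q) ^ n\<close> times the series with coefficients \<open>m ^ n * F\<^sub>m\<close>, again
  evaluated at \<open>q powr x\<close>. The series is nonnegative there, and the sign of \<open>(ln q) ^ n\<close> is that
  of \<open>(-1) ^ n\<close>.
\<close>

lemma completely_monotonic_on_power_series:
  fixes F :: "real fps"
  assumes q: "0 < q" "q < 1" and rad: "1 \<le> fps_conv_radius F"
    and nonneg: "\<And>m. 0 \<le> fps_nth F m"
    and f: "\<And>x. 0 < x \<Longrightarrow> f x = eval_fps F (q powr x)"
  shows "completely_monotonic_on {0<..} f"
proof -
  have t: "q powr x < 1" if "0 < x" for x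
    using q that by (simp add: powr01_less_one)
  have rad': "1 \<le> fps_conv_radius ((fps_XD ^^ n) F)" for n
    by (induction n) (auto intro: rad order_trans[OF _ fps_conv_radius_XD])
  have in_disc: "ereal (q powr x) < fps_conv_radius ((fps_XD ^^ n) F)" if "0 < x" for x n
    using less_conv_radius[OF _ rad', of "q powr x"] t[OF that] by simp
  \<comment> \<open>The formula at \<open>n\<close> is differentiated near \<open>x\<close>, so it is needed on all of \<open>{0<..}\<close>.\<close>
  have step: "((deriv ^^ n) f has_field_derivative
                (ln q) ^ Suc n * eval_fps ((fps_XD ^^ Suc n) F) (q powr x)) (at x)"
    if eq: "\<And>y. 0 < y \<Longrightarrow> (deriv ^^ n) f y = (ln q) ^ n * eval_fps ((fps_XD ^^ n) F) (q powr y)"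
      and x: "0 < x" for n x
  proof (rule has_field_derivative_transform_within_open[where S = "{0<..}"])
    show "((\<lambda>y. (ln q) ^ n * eval_fps ((fps_XD ^^ n) F) (q powr y)) has_field_derivative
             (ln q) ^ Suc n * eval_fps ((fps_XD ^^ Suc n) F) (q powr x)) (at x)"
      using DERIV_cmult[OF has_field_derivative_eval_fps_powr[OF q(1) in_disc[OF x]],
          of "(ln q) ^ n"] by (simp add: mult_ac)
  qed (use x in \<open>auto simp: eq\<close>)
  have deriv_eq: "(deriv ^^ n) f x = (ln q) ^ n * eval_fps ((fps_XD ^^ n) F) (q powr x)"
    if "0 < x" for n x
    using that
  proof (induction n arbitrary: x)
    case (Suc n)
    then show ?case using DERIV_imp_deriv[OF step] by simp
  qed (simp add: f)
  have "0 \<le> (-1) ^ n * (deriv ^^ n) f x" if "0 < x" for n x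
  proof -
    have "0 \<le> eval_fps ((fps_XD ^^ n) F) (q powr x)"
      unfolding eval_fps_def using in_disc[OF that]
      by (intro suminf_nonneg summable_fps) (auto simp: fps_mult_fps_XD_shift nonneg)
    moreover have "0 \<le> (- ln q) ^ n"
      using q by simp
    moreover have "(-1) ^ n * (deriv ^^ n) f x =
        (- ln q) ^ n * eval_fps ((fps_XD ^^ n) F) (q powr x)"
      using that by (simp add: deriv_eq power_minus[of "ln q"])
    ultimately show ?thesis by simp
  qed
  moreover have "(deriv ^^ n) f differentiable (at x)" if "0 < x" for n x
    using step[OF deriv_eq that] by (auto simp: real_differentiable_def)
  ultimately show ?thesis by (simp add: completely_monotonic_on_def)
qed

section \<open>Quotients of (p,q)-Gamma functions\<close>

lemma q_bracket_pos: "0 < q \<Longrightarrow> q < 1 \<Longrightarrow> 0 < x \<Longrightarrow> 0 < q_bracket q x"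
  by (simp add: q_bracket_def powr01_less_one)

lemma Gamma_pq_quotient:
  assumes q: "0 < q" "q < 1" and p: "p \<ge> 1"
  shows "Gamma_pq p q y / Gamma_pq p q z =
    q_bracket q (real p) powr (y - z) *
      (\<Prod>k=0..p. (1 - q powr (z + real k)) / (1 - q powr (y + real k)))"
proof -
  have "0 < q_fact q p"
    unfolding q_fact_def using q by (intro prod_pos) (auto intro: q_bracket_pos)
  moreover have "0 < q_bracket q (real p)"
    using p q by (intro q_bracket_pos) auto
  moreover have "(\<Prod>k=0..p. (1 - q powr (z + real k)) / (1 - q powr (y + real k))) =
      (\<Prod>k=0..p. q_bracket q (z + real k)) / (\<Prod>k=0..p. q_bracket q (y + real k))"
    unfolding prod_dividef[symmetric] using q by (intro prod.cong) (auto simp: q_bracket_def)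
  ultimately show ?thesis by (simp add: Gamma_pq_def powr_diff)
qed

theorem theorem3p1:
  fixes p n :: nat and q :: real and a b :: "nat \<Rightarrow> real"
  assumes "p \<ge> 1" and "n \<ge> 1"
    and "0 < q" and "q < 1"
    and "0 < a 1" and "\<And>i. 1 \<le> i \<Longrightarrow> i < n \<Longrightarrow> a i \<le> a (i + 1)"
    and "0 < b 1" and "\<And>i. 1 \<le> i \<Longrightarrow> i < n \<Longrightarrow> b i \<le> b (i + 1)"
    and "\<And>k. 1 \<le> k \<Longrightarrow> k \<le> n \<Longrightarrow> (\<Sum>i=1..k. a i) \<le> (\<Sum>i=1..k. b i)"
  shows "completely_monotonic_on {0<..}
           (\<lambda>x. \<Prod>i=1..n. Gamma_pq p q (x + a i) / Gamma_pq p q (x + b i))"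
proof -
  note q = \<open>0 < q\<close> \<open>q < 1\<close>
  define A where "A = {1..n} \<times> {0..p}"
  define \<alpha> where "\<alpha> = (\<lambda>(i, k). q powr (a i + real k))"
  define \<beta> where "\<beta> = (\<lambda>(i, k). q powr (b i + real k))"
  define C where "C = (\<Prod>i=1..n. q_bracket q (real p) powr (a i - b i))"
  define P where "P = (\<Prod>j\<in>A. linear_quotient_fps (\<alpha> j) (\<beta> j))"

  have a_pos: "0 < a i" if "1 \<le> i" "i \<le> n" for i
    using that
  proof (induction i rule: dec_induct)
    case (step i)
    then show ?case using assms(6)[of i] by simp
  qed (use assms in simp)
  have \<alpha>: "norm (\<alpha> j) \<le> 1" if "j \<in> A" for j
    using that q
    by (auto simp: A_def \<alpha>_def intro!: powr_le1 add_nonneg_nonneg less_imp_le[OF a_pos])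

  have P_rad: "1 \<le> fps_conv_radius P"
    unfolding P_def
    by (intro fps_conv_radius_prod_ge fps_conv_radius_linear_quotient_fps \<alpha>) (simp add: A_def)

  \<comment> \<open>The formal logarithmic derivative of \<open>P\<close>.\<close>
  define D where "D = (\<Sum>j\<in>A. Abs_fps (\<lambda>m. \<alpha> j ^ (m + 1) - \<beta> j ^ (m + 1)))"
  have "0 \<le> fps_nth P m" for m
  proof (rule fps_nonneg_of_log_deriv_nonneg)
    show "fps_deriv P = D * P"
      unfolding P_def D_def by (intro fps_log_deriv_prod fps_deriv_linear_quotient_fps) (simp add: A_def)
    show "0 \<le> fps_nth P 0"
      by (simp add: P_def fps_nth_0_prod linear_quotient_fps_def geometric_fps_def)
    fix m
    define s where "s = q ^ (m + 1)"
    have s: "0 < s" "s \<le> 1" using q by (auto simp: s_def power_le_one simp del: power_Suc)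
    \<comment> \<open>Used with \<open>u = a i\<close> and \<open>u = b i\<close>: the shift \<open>k\<close> only contributes the common factor
      \<open>s ^ k\<close>, so one majorization inequality serves all \<open>k\<close>.\<close>
    have pow: "(q powr (u + real k)) ^ (m + 1) = s ^ k * s powr u" for u k
    proof -
      have "s = q powr real (m + 1)"
        unfolding s_def using q by (intro powr_realpow[symmetric])
      then have "s powr real k * s powr u = (q powr (u + real k)) powr real (m + 1)"
        by (simp only: powr_powr flip: powr_add) (simp add: algebra_simps)
      also have "\<dots> = (q powr (u + real k)) ^ (m + 1)"
        using q by (intro powr_realpow) simp
      finally show ?thesis using s by (simp add: powr_realpow)
    qed
    have "0 \<le> (\<Sum>k=0..p. s ^ k * ((\<Sum>i=1..n. s powr a i) - (\<Sum>i=1..n. s powr b i)))"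
      using sum_powr_le_of_partial_sums_le[OF assms(2) s assms(8,9)] s
      by (intro sum_nonneg mult_nonneg_nonneg) auto
    also have "\<dots> = (\<Sum>k=0..p. \<Sum>i=1..n. s ^ k * s powr a i - s ^ k * s powr b i)"
      by (simp add: sum_subtractf sum_distrib_left right_diff_distrib)
    also have "\<dots> = (\<Sum>i=1..n. \<Sum>k=0..p. s ^ k * s powr a i - s ^ k * s powr b i)"
      by (rule sum.swap)
    also have "\<dots> = (\<Sum>(i, k)\<in>A. s ^ k * s powr a i - s ^ k * s powr b i)"
      by (simp add: A_def sum.cartesian_product)
    also have "\<dots> = (\<Sum>j\<in>A. \<alpha> j ^ (m + 1) - \<beta> j ^ (m + 1))"
      by (intro sum.cong) (auto simp: \<alpha>_def \<beta>_def pow[unfolded Suc_eq_plus1[symmetric]] simp del: power_Suc)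
    also have "\<dots> = fps_nth D m"
      by (simp add: D_def fps_sum_nth)
    finally show "0 \<le> fps_nth D m" .
  qed
  moreover have C: "0 \<le> C"
    by (simp add: C_def prod_nonneg)
  ultimately have nonneg: "0 \<le> fps_nth (fps_const C * P) m" for m
    by simp

  have rad: "1 \<le> fps_conv_radius (fps_const C * P)"
    using fps_conv_radius_mult[of "fps_const C" P] P_rad by simp

  show ?thesis
  proof (rule completely_monotonic_on_power_series[OF q rad nonneg])
    fix x :: real assume "0 < x"
    then have t: "norm (q powr x) < 1" using q by (simp add: powr01_less_one)
    have "(\<Prod>i=1..n. Gamma_pq p q (x + a i) / Gamma_pq p q (x + b i)) =
        C * (\<Prod>i=1..n. \<Prod>k=0..p.
          (1 - q powr (x + b i + real k)) / (1 - q powr (x + a i + real k)))"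
      using q assms(1) by (simp add: Gamma_pq_quotient C_def prod.distrib)
    also have "\<dots> = C * (\<Prod>(i, k)\<in>A.
          (1 - q powr (x + b i + real k)) / (1 - q powr (x + a i + real k)))"
      by (simp add: A_def prod.cartesian_product)
    also have "\<dots> = C * (\<Prod>j\<in>A. (1 - \<beta> j * q powr x) / (1 - \<alpha> j * q powr x))"
      by (intro arg_cong[of _ _ "(*) C"] prod.cong) (auto simp: \<alpha>_def \<beta>_def powr_add mult_ac)
    also have "\<dots> = C * (\<Prod>j\<in>A. eval_fps (linear_quotient_fps (\<alpha> j) (\<beta> j)) (q powr x))"
      using t \<alpha> by (simp add: eval_linear_quotient_fps)
    also have "\<dots> = C * eval_fps P (q powr x)"
      unfolding P_def using t \<alpha>
      by (subst eval_fps_prod[where r = 1])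
        (auto intro: fps_conv_radius_linear_quotient_fps simp: A_def simp flip: one_ereal_def)
    also have "\<dots> = eval_fps (fps_const C * P) (q powr x)"
      using less_conv_radius[OF t P_rad] by (simp add: eval_fps_mult)
    finally show "(\<Prod>i=1..n. Gamma_pq p q (x + a i) / Gamma_pq p q (x + b i)) =
        eval_fps (fps_const C * P) (q powr x)" .
  qed
qed

end
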